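(* Let $H$ be a real separable Hilbert space with Borel $\sigma$-algebra $\mathcal B(H)$. Let $(\gamma_k)_{k\ge1}$ be Gaussian probability measures on $(H,\mathcal B(H))$, with means $m_k$ and covariance operators $\Sigma_k$, and let $(\pi_k)_{k\ge1}$ be real numbers with $\pi_k\ge0$ for all $k$ and $\sum_{k=1}^\infty\pi_k=1$. Define $$\mu(A)=\sum_{k=1}^\infty\pi_k\gamma_k(A),\qquad A\in\mathcal B(H).$$ Then $\mu$ is a probability measure on $(H,\mathcal B(H))$.
   Context: A Gaussian measure on $H$ with mean $m\in H$ and covariance operator $\Sigma:H\to H$ (positive, self-adjoint, trace-class) is the Gaussian probability measure $\gamma=\mathcal N(m,\Sigma)$ on $(H,\mathcal B(H))$ satisfying $\langle\Sigma u,v\rangle=\int_H\langle x-m,u\rangle\langle x-m,v\rangle\,d\gamma(x)$ for all $u,v\in H$. *)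

theory Defs
  imports "HOL-Probability.Probability"
begin

(* A real separable Hilbert space is a type of sort
   {real_inner, complete_space, second_countable_topology}; for metric spaces, second
   countability is separability. *)

definition orthonormal_basis :: "'a::real_inner set \<Rightarrow> bool" where
  "orthonormal_basis B \<longleftrightarrow>
     (\<forall>e\<in>B. norm e = 1) \<and> (\<forall>e\<in>B. \<forall>f\<in>B. e \<noteq> f \<longrightarrow> e \<bullet> f = 0) \<and>
     closure (span B) = UNIV"

definition self_adjoint_op :: "('a::real_inner \<Rightarrow> 'a) \<Rightarrow> bool" where
  "self_adjoint_op T \<longleftrightarrow> bounded_linear T \<and> (\<forall>x y. T x \<bullet> y = x \<bullet> T y)"

definition positive_op :: "('a::real_inner \<Rightarrow> 'a) \<Rightarrow> bool" where
  "positive_op T \<longleftrightarrow> bounded_linear T \<and> (\<forall>x. 0 \<le> T x \<bullet> x)"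

(* P is the absolute value |T|, the positive square root of T*T: for self-adjoint P,
   the equation P P = T*T says that P x \<bullet> P y = T x \<bullet> T y for all x, y. *)
definition is_abs_op :: "('a::real_inner \<Rightarrow> 'a) \<Rightarrow> ('a \<Rightarrow> 'a) \<Rightarrow> bool" where
  "is_abs_op T P \<longleftrightarrow>
     self_adjoint_op P \<and> positive_op P \<and> (\<forall>x y. P x \<bullet> P y = T x \<bullet> T y)"

(* The trace of |T| is finite; its value does not depend on the orthonormal basis. *)
definition trace_class_op :: "('a::real_inner \<Rightarrow> 'a) \<Rightarrow> bool" where
  "trace_class_op T \<longleftrightarrow> bounded_linear T \<and>
     (\<exists>P B. is_abs_op T P \<and> orthonormal_basis B \<and> (\<lambda>e. P e \<bullet> e) summable_on B)"

(* N(a, v) on the line, including the degenerate case v = 0. The library's normal_density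
   takes the standard deviation. *)
definition real_gaussian :: "real \<Rightarrow> real \<Rightarrow> real measure" where
  "real_gaussian a v =
     (if v = 0 then return borel a
      else density lborel (\<lambda>x. ennreal (normal_density a (sqrt v) x)))"

(* By the Riesz representation theorem the maps x \<mapsto> x \<bullet> u are all the continuous linear
   functionals. *)
definition gaussian_measure :: "'a::real_inner measure \<Rightarrow> bool" where
  "gaussian_measure M \<longleftrightarrow> prob_space M \<and> sets M = sets borel \<and>
     (\<forall>u. \<exists>a v. 0 \<le> v \<and> distr M borel (\<lambda>x. x \<bullet> u) = real_gaussian a v)"

definition gaussian_mean_cov :: "'a::real_inner measure \<Rightarrow> 'a \<Rightarrow> ('a \<Rightarrow> 'a) \<Rightarrow> bool" where
  "gaussian_mean_cov M m C \<longleftrightarrow> gaussian_measure M \<and>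
     (\<forall>u. has_bochner_integral M (\<lambda>x. x \<bullet> u) (m \<bullet> u)) \<and>
     positive_op C \<and> self_adjoint_op C \<and> trace_class_op C \<and>
     (\<forall>u v. has_bochner_integral M (\<lambda>x. ((x - m) \<bullet> u) * ((x - m) \<bullet> v)) (C u \<bullet> v))"

end

theory Submission
  imports Defs
begin

text \<open>Countable additivity of the mixture amounts to exchanging two series, one over the
  disjoint pieces of a set and one over the components. All terms lie in [0, \<infinity>], so the
  exchange is unconditional (\<open>suminf_swap_ennreal\<close>);
  \<open>measure_space_mixture\<close> draws the conclusion for arbitrary measures and weights in
  [0, \<infinity>]. The total mass is then the sum of the weights, since a Gaussian component enters
  as a Borel probability measure, of mass 1.\<close>

lemma suminf_swap_ennreal:
  fixes f :: "nat \<Rightarrow> nat \<Rightarrow> ennreal"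
  shows "(\<Sum>i. \<Sum>j. f i j) = (\<Sum>j. \<Sum>i. f i j)"
proof -
  have "(\<Sum>i. \<Sum>j. f i j) = (\<Sum>i. \<integral>\<^sup>+ j. f i j \<partial>count_space UNIV)"
    by (simp add: nn_integral_count_space_nat)
  \<comment> \<open>With the inner series read as an integral against counting measure, the exchange
    is monotone convergence for a series of nonnegative functions.\<close>
  also have "\<dots> = (\<integral>\<^sup>+ j. (\<Sum>i. f i j) \<partial>count_space UNIV)"
    by (rule nn_integral_suminf[symmetric]) simp
  also have "\<dots> = (\<Sum>j. \<Sum>i. f i j)"
    by (simp add: nn_integral_count_space_nat)
  finally show ?thesis .
qed

text \<open>After the two series are exchanged, each weight factors out of its inner series and the
  countable additivity of each \<open>N k\<close> applies. The values of \<open>\<mu>\<close>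
  outside \<open>sets M\<close> are left free.\<close>

lemma measure_space_mixture:
  fixes c :: "nat \<Rightarrow> ennreal" and N :: "nat \<Rightarrow> 'a measure"
  assumes sets_N: "\<And>k. sets (N k) = sets M"
    and mixture: "\<And>A. A \<in> sets M \<Longrightarrow> \<mu> A = (\<Sum>k. c k * emeasure (N k) A)"
  shows "measure_space (space M) (sets M) \<mu>"
proof -
  have "(\<Sum>i. \<mu> (A i)) = \<mu> (\<Union>i. A i)"
    if A: "range A \<subseteq> sets M" "disjoint_family A" for A :: "nat \<Rightarrow> 'a set"
  proof -
    have "(\<Sum>i. \<mu> (A i)) = (\<Sum>i. \<Sum>k. c k * emeasure (N k) (A i))"
      using A by (intro arg_cong[where f = suminf] ext mixture) auto
    also have "\<dots> = (\<Sum>k. c k * (\<Sum>i. emeasure (N k) (A i)))"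
      by (subst suminf_swap_ennreal) simp
    also have "\<dots> = (\<Sum>k. c k * emeasure (N k) (\<Union>i. A i))"
      using A by (simp add: suminf_emeasure sets_N)
    also have "\<dots> = \<mu> (\<Union>i. A i)"
      using A by (intro mixture[symmetric]) auto
    finally show ?thesis .
  qed
  moreover have "\<mu> {} = 0"
    by (simp add: mixture)
  ultimately show ?thesis
    by (simp add: measure_space_def positive_def countably_additive_def sets.sigma_algebra_axioms)
qed

theorem lemma2p2:
  fixes \<gamma> :: "nat \<Rightarrow> 'a::{real_inner, complete_space, second_countable_topology} measure"
    and m :: "nat \<Rightarrow> 'a"
    and C :: "nat \<Rightarrow> 'a \<Rightarrow> 'a"
    and \<pi> :: "nat \<Rightarrow> real"
    and \<mu> :: "'a set \<Rightarrow> ennreal"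
  assumes gaussian: "\<And>k. k \<ge> 1 \<Longrightarrow> gaussian_mean_cov (\<gamma> k) (m k) (C k)"
    and nonneg: "\<And>k. k \<ge> 1 \<Longrightarrow> 0 \<le> \<pi> k"
    and weights: "(\<lambda>k. \<pi> (Suc k)) sums 1"
    and mixture: "\<And>A. A \<in> sets borel \<Longrightarrow>
        \<mu> A = (\<Sum>k. ennreal (\<pi> (Suc k)) * emeasure (\<gamma> (Suc k)) A)"
  shows "measure_space (space borel) (sets borel) \<mu> \<and>
         prob_space (measure_of (space borel) (sets borel) \<mu>)"
proof -
  have prob: "prob_space (\<gamma> (Suc k))" and sets_\<gamma>: "sets (\<gamma> (Suc k)) = sets borel" for k
    using gaussian[of "Suc k"] by (auto simp: gaussian_mean_cov_def gaussian_measure_def)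
  have ms: "measure_space (space borel) (sets borel) \<mu>"
    using sets_\<gamma> mixture by (rule measure_space_mixture)
  have "emeasure (\<gamma> (Suc k)) UNIV = 1" for k
    using prob_space.emeasure_space_1[OF prob] sets_eq_imp_space_eq[OF sets_\<gamma>] by simp
  then have "\<mu> UNIV = (\<Sum>k. ennreal (\<pi> (Suc k)))"
    by (simp add: mixture)
  \<comment> \<open>Nonnegativity matters here: \<open>ennreal\<close> sends negative reals to 0, so
    only for nonnegative weights does the real sum carry over.\<close>
  also have "\<dots> = ennreal 1"
    by (rule suminf_ennreal_eq[OF _ weights]) (simp add: nonneg)
  finally have "\<mu> UNIV = 1"
    by simp
  \<comment> \<open>\<open>measure_of\<close> falls back to the zero measure when its set function
    is not a measure, so \<open>ms\<close> is what makes it agree with \<open>\<mu>\<close>.\<close>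
  moreover have "emeasure (measure_of (space borel) (sets borel) \<mu>) UNIV = \<mu> UNIV"
    using ms by (intro emeasure_measure_of_sigma) (auto simp: measure_space_def)
  ultimately have "prob_space (measure_of (space borel) (sets borel) \<mu>)"
    by (intro prob_spaceI) (simp add: space_measure_of_conv)
  with ms show ?thesis ..
qed

end
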